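(* For every $0<\alpha<1$, the function $$h_\alpha(s)=\frac{1}{1+(1-\alpha)s^{\alpha-1}},\qquad s>0,$$ is not completely monotone on $(0,\infty)$.
   Context: A function $g\in C^\infty(0,\infty)$ is completely monotone on $(0,\infty)$ if $(-1)^n g^{(n)}(s)\ge 0$ for all integers $n\ge 0$ and all $s>0$. *)

theory Defs
  imports "HOL-Analysis.Analysis"
begin

(* C^infinity(0,infinity): all iterated derivatives exist at every point of the open half-line.
   Values of g outside (0,infinity) are irrelevant, since deriv only depends on the germ of g. *)
definition smooth_on_pos :: "(real \<Rightarrow> real) \<Rightarrow> bool" where
  "smooth_on_pos g \<longleftrightarrow> (\<forall>n::nat. \<forall>s>0. ((deriv ^^ n) g) differentiable (at s))"

definition completely_monotone :: "(real \<Rightarrow> real) \<Rightarrow> bool" where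
  "completely_monotone g \<longleftrightarrow>
     smooth_on_pos g \<and> (\<forall>n::nat. \<forall>s>0. (-1) ^ n * (deriv ^^ n) g s \<ge> 0)"

definition h :: "real \<Rightarrow> real \<Rightarrow> real" where
  "h \<alpha> s = 1 / (1 + (1 - \<alpha>) * s powr (\<alpha> - 1))"

end

theory Submission
  imports Defs
begin

text \<open>Complete monotonicity already fails at the first derivative. The sign condition for n =
  1 makes such a function nonincreasing (\<open>completely_monotone_antimono\<close>), whereas
  \<alpha> < 1 makes h strictly increasing (\<open>h_strict_mono\<close>).\<close>

lemma completely_monotone_antimono:
  assumes "completely_monotone g" and "0 < a" and "a \<le> b"
  shows "g b \<le> g a"
proof (rule DERIV_nonpos_imp_nonincreasing[OF \<open>a \<le> b\<close>])
  fix x :: real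
  assume "a \<le> x"
  with \<open>0 < a\<close> have "0 < x" by simp
  \<comment> \<open>Order 0 of smoothness makes \<open>deriv g x\<close> a genuine derivative; order
    1 of the sign condition bounds it by 0.\<close>
  with assms(1) have "((deriv ^^ 0) g) differentiable (at x)"
    and "(-1) ^ 1 * (deriv ^^ 1) g x \<ge> 0"
    unfolding completely_monotone_def smooth_on_pos_def by blast+
  then have "g differentiable (at x)" and "deriv g x \<le> 0" by simp_all
  then show "\<exists>y. DERIV g x :> y \<and> y \<le> 0"
    using DERIV_deriv_iff_real_differentiable by blast
qed

text \<open>The exponent \<alpha> - 1 is negative, so the denominator strictly decreases.\<close>

lemma h_strict_mono:
  assumes "\<alpha> < 1" and "0 < s" and "s < t"
  shows "h \<alpha> s < h \<alpha> t"
proof -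
  have "t powr (\<alpha> - 1) < s powr (\<alpha> - 1)"
    using assms by (intro powr_less_mono2_neg) auto
  then have "(1 - \<alpha>) * t powr (\<alpha> - 1) < (1 - \<alpha>) * s powr (\<alpha> - 1)"
    using assms(1) by simp
  \<comment> \<open>Both denominators are thus at least 1, so taking reciprocals reverses the strict
    inequality.\<close>
  moreover have "0 \<le> (1 - \<alpha>) * t powr (\<alpha> - 1)"
    using assms(1) by simp
  ultimately show ?thesis
    unfolding h_def by (intro divide_strict_left_mono) auto
qed

theorem proposition3p1:
  fixes \<alpha> :: real
  assumes "0 < \<alpha>" and "\<alpha> < 1"
  shows "\<not> completely_monotone (h \<alpha>)"
proof
  assume "completely_monotone (h \<alpha>)"
  \<comment> \<open>Any two distinct positive points would serve as well as 1 and 2.\<close>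
  then have "h \<alpha> 2 \<le> h \<alpha> 1"
    by (rule completely_monotone_antimono) simp_all
  moreover have "h \<alpha> 1 < h \<alpha> 2"
    using assms(2) by (rule h_strict_mono) simp_all
  ultimately show False by simp
qed

end
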